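(* Let $n\ge 3$, $b<-2$, and let $\widetilde b\in\mathbb{R}$ be such that $\widetilde T_n$ is nonsingular. Put $\beta=\widetilde b-b$. Then $$\operatorname{Tr}(\widetilde T_n^{-1})=K_1\left(\frac{n+1}{\sqrt{b^2-4}}\,\frac{r_1^{n+1}+r_2^{n+1}}{\gamma_{n+1}}-\frac{b}{b^2-4}\right)-K_2\left(\frac{b}{\sqrt{b^2-4}}\left(r_1^{n+1}+r_2^{n+1}\right)-\gamma_{n+1}-\frac{4(n+1)}{\gamma_{n+1}}\right),$$ where $$K_1=\frac{[\gamma_{n+1}+\beta\gamma_n]^2+\beta^2(b^2-4)}{[\gamma_{n+1}+\beta\gamma_n]^2-\beta^2(b^2-4)},\qquad K_2=\frac{\beta[\gamma_{n+1}+\beta\gamma_n]}{[\gamma_{n+1}+\beta\gamma_n]^2-\beta^2(b^2-4)}.$$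
   Context: For an integer $n\ge 3$ and real $b,\widetilde b$, $\widetilde T_n$ is the $n\times n$ real symmetric tridiagonal matrix with diagonal entries $(\widetilde b,b,b,\dots,b,\widetilde b)$ (first and last equal to $\widetilde b$, all others equal to $b$) and all sub- and superdiagonal entries equal to $-1$. For $b<-2$ put $r_1=\tfrac12(b+\sqrt{b^2-4})$, $r_2=\tfrac12(b-\sqrt{b^2-4})$ and $\gamma_k=r_1^k-r_2^k$ for integers $k\ge 0$. *)

theory Defs
  imports Complex_Main "Jordan_Normal_Form.Gauss_Jordan_Elimination"
begin

(* Rows and columns are numbered from 0, so the corner entries are at 0 and n - 1. *)
definition T_tilde :: "nat \<Rightarrow> real \<Rightarrow> real \<Rightarrow> real mat" where
  "T_tilde n b bt = mat n n (\<lambda>(i, j).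
     if i = j then (if i = 0 \<or> Suc i = n then bt else b)
     else if i = Suc j \<or> j = Suc i then -1
     else 0)"

definition mat_trace :: "'a :: comm_monoid_add mat \<Rightarrow> 'a" where
  "mat_trace A = (\<Sum>i<dim_row A. A $$ (i, i))"

definition r1 :: "real \<Rightarrow> real" where
  "r1 b = (b + sqrt (b\<^sup>2 - 4)) / 2"

definition r2 :: "real \<Rightarrow> real" where
  "r2 b = (b - sqrt (b\<^sup>2 - 4)) / 2"

definition gam :: "real \<Rightarrow> nat \<Rightarrow> real" where
  "gam b k = r1 b ^ k - r2 b ^ k"

(* The third argument of K1 and K2 is the perturbation bt - b of the corner entries. *)
definition K1 :: "nat \<Rightarrow> real \<Rightarrow> real \<Rightarrow> real" where
  "K1 n b \<beta> =
     ((gam b (n + 1) + \<beta> * gam b n)\<^sup>2 + \<beta>\<^sup>2 * (b\<^sup>2 - 4)) /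
     ((gam b (n + 1) + \<beta> * gam b n)\<^sup>2 - \<beta>\<^sup>2 * (b\<^sup>2 - 4))"

definition K2 :: "nat \<Rightarrow> real \<Rightarrow> real \<Rightarrow> real" where
  "K2 n b \<beta> =
     (\<beta> * (gam b (n + 1) + \<beta> * gam b n)) /
     ((gam b (n + 1) + \<beta> * gam b n)\<^sup>2 - \<beta>\<^sup>2 * (b\<^sup>2 - 4))"

(* The library's mat_inverse is an option computed by Gauss-Jordan elimination; on an
   invertible matrix it is the two-sided inverse. *)
lemma the_mat_inverse:
  fixes A :: "'a :: field mat"
  assumes "A \<in> carrier_mat n n" "invertible_mat A"
  shows "the (mat_inverse A) \<in> carrier_mat n n"
    and "inverts_mat A (the (mat_inverse A))"
    and "inverts_mat (the (mat_inverse A)) A"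
proof -
  obtain B where B: "A * B = 1\<^sub>m (dim_row A)" "B * A = 1\<^sub>m (dim_row B)"
    using assms(2) unfolding invertible_mat_def inverts_mat_def by blast
  have "dim_col B = n"
    using arg_cong[OF B(1), of dim_col] assms(1) by simp
  moreover have "dim_row B = n"
    using arg_cong[OF B(2), of dim_col] assms(1) by simp
  ultimately have "B \<in> carrier_mat n n" by blast
  then have "A \<in> Units (ring_mat TYPE('a) n ())"
    using B assms(1) by (auto simp: Units_def ring_mat_def)
  then obtain C where C: "mat_inverse A = Some C"
    using mat_inverse(1)[OF assms(1), where b = "()"] by (cases "mat_inverse A") auto
  have "A * C = 1\<^sub>m n \<and> C * A = 1\<^sub>m n \<and> C \<in> carrier_mat n n"
    using mat_inverse(2)[OF assms(1) C] .
  then show "the (mat_inverse A) \<in> carrier_mat n n"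
    and "inverts_mat A (the (mat_inverse A))"
    and "inverts_mat (the (mat_inverse A)) A"
    using C assms(1) by (auto simp: inverts_mat_def)
qed

end

theory Submission
  imports Defs
begin

text \<open>With \<open>u i = \<gamma> (i + 1) + \<beta> * \<gamma> i\<close>, the sequence \<open>u\<close> solves the three-term recurrence
  of the matrix together with the first boundary condition, and by symmetry its reversal solves it
  together with the last one. Hence the matrix with entries \<open>u (min i j) * u (n - 1 - max i j)\<close> is
  the inverse times the Casoratian \<open>w\<close> of the two solutions. Nonsingularity forces \<open>w \<noteq> 0\<close>, since the
  corner entry \<open>u 0 * u 0 = b\<^sup>2 - 4\<close> does not vanish. As \<open>u\<close> is a combination of \<open>r\<^sub>1 ^ i\<close> and
  \<open>r\<^sub>2 ^ i\<close>, the trace is a sum of geometric sums, and the formula becomes a polynomial identity modulo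
  \<open>r\<^sub>1 * r\<^sub>2 = 1\<close>.\<close>

section \<open>The discrete Green's function of the tridiagonal matrix\<close>

definition green_mat :: "(nat \<Rightarrow> 'a :: semiring_1) \<Rightarrow> nat \<Rightarrow> 'a mat" where
  "green_mat u n = mat n n (\<lambda>(i, j). u (min i j) * u (n - 1 - max i j))"

lemma green_mat_carrier [simp]: "green_mat u n \<in> carrier_mat n n"
  by (simp add: green_mat_def)

lemma T_tilde_carrier [simp]: "T_tilde n b bt \<in> carrier_mat n n"
  by (simp add: T_tilde_def)

lemma T_tilde_row_sum:
  assumes "n \<ge> 2" "i < n"
  shows "(\<Sum>k = 0..<n. T_tilde n b bt $$ (i, k) * x k) =
    (if i = 0 \<or> Suc i = n then bt else b) * x i
      - (if i = 0 then 0 else x (i - 1)) - (if Suc i = n then 0 else x (Suc i))"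
proof -
  have "(\<Sum>k = 0..<n. T_tilde n b bt $$ (i, k) * x k) =
    (\<Sum>k = 0..<n. (if k = i then (if i = 0 \<or> Suc i = n then bt else b) * x i else 0)
       - (if k = i - 1 then (if i = 0 then 0 else x (i - 1)) else 0)
       - (if k = Suc i then x (Suc i) else 0))"
    using assms by (intro sum.cong) (auto simp: T_tilde_def)
  also have "\<dots> = (if i = 0 \<or> Suc i = n then bt else b) * x i
      - (if i = 0 then 0 else x (i - 1)) - (if Suc i = n then 0 else x (Suc i))"
    using assms by (auto simp: sum_subtractf)
  finally show ?thesis .
qed

text \<open>Away from the diagonal, a column of \<open>green_mat u n\<close> is locally a multiple
  of \<open>u\<close> or of its reversal, so the recurrence or a boundary condition gives 0. At the
  diagonal the two solutions are glued, and the defect is their Casoratian.\<close>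

lemma T_tilde_mult_green_mat:
  assumes "n \<ge> 2"
    and u1: "u 1 = bt * u 0"
    and rec: "\<And>i. u (Suc (Suc i)) = b * u (Suc i) - u i"
    and cas: "\<And>i. Suc i < n \<Longrightarrow> u (Suc i) * u (n - 1 - i) - u i * u (n - 2 - i) = w"
  shows "T_tilde n b bt * green_mat u n = w \<cdot>\<^sub>m 1\<^sub>m n"
proof (rule eq_matI)
  fix i j assume "i < dim_row (w \<cdot>\<^sub>m 1\<^sub>m n)" "j < dim_col (w \<cdot>\<^sub>m 1\<^sub>m n)"
  then have ij: "i < n" "j < n" by auto
  define g where "g = (\<lambda>k. u (min k j) * u (n - 1 - max k j))"
  have "(T_tilde n b bt * green_mat u n) $$ (i, j) = (\<Sum>k = 0..<n. T_tilde n b bt $$ (i, k) * g k)"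
    using ij by (simp add: scalar_prod_def green_mat_def T_tilde_def g_def)
  also have "\<dots> = (if i = 0 \<or> Suc i = n then bt else b) * g i
      - (if i = 0 then 0 else g (i - 1)) - (if Suc i = n then 0 else g (Suc i))"
    by (rule T_tilde_row_sum[OF assms(1) ij(1)])
  also have "\<dots> = (if i = j then w else 0)"
  proof -
    consider "i < j" | "i = j" "Suc i < n" | "i = j" "Suc i = n" | "j < i"
      using ij by linarith
    then show ?thesis
    proof cases
      case 1
      show ?thesis
      proof (cases i)
        case 0
        then show ?thesis using 1 ij u1 by (simp add: g_def)
      next
        case (Suc k)
        then have "g i = u (Suc k) * u (n - 1 - j)" "g (i - 1) = u k * u (n - 1 - j)"
          "g (Suc i) = u (Suc (Suc k)) * u (n - 1 - j)"
          using 1 by (simp_all add: g_def)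
        then show ?thesis using 1 ij Suc by (simp add: rec algebra_simps)
      qed
    next
      case 2
      have s: "g i = u i * u (n - 1 - i)" "g (Suc i) = u i * u (n - 2 - i)"
        using 2 by (simp_all add: g_def max_def)
      show ?thesis
      proof (cases i)
        case 0
        then show ?thesis using 2 s u1 cas[of 0] by (simp add: algebra_simps)
      next
        case (Suc k)
        then have "g (i - 1) = u k * u (n - 1 - i)" "i \<noteq> 0"
          "b * g i = u (Suc i) * u (n - 1 - i) + u k * u (n - 1 - i)"
          using 2 s by (simp_all add: g_def rec algebra_simps)
        then show ?thesis
          using 2 s(2) cas[of i] by simp
      qed
    next
      case 3
      \<comment> \<open>The hypothesis \<open>cas\<close> stops before the last row, so it is read
        one index earlier; there \<open>u 1\<close> appears and becomes
        \<open>bt * u 0\<close>.\<close>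
      then obtain k where k: "i = Suc k" "n = Suc (Suc k)"
        using assms(1) by (cases i) auto
      have "g i = u (Suc k) * u 0" "g (i - 1) = u k * u 0"
        unfolding g_def 3(1)[symmetric] k by (simp_all add: mult.commute)
      moreover have "u (Suc k) * (bt * u 0) - u k * u 0 = w"
        using cas[of k] k u1 by simp
      ultimately show ?thesis
        using 3 k by (simp add: algebra_simps)
    next
      case 4
      then obtain k where k: "i = Suc k" by (cases i) auto
      have g: "g i = u j * u (n - 1 - i)" "g (i - 1) = u j * u (n - i)"
        using 4 k by (simp_all add: g_def max_absorb1 min_absorb2)
      show ?thesis
      proof (cases "Suc i = n")
        case True
        then have "n - i = 1" by simp
        then show ?thesis using 4 g True u1 by (simp add: algebra_simps)
      next
        case False
        then obtain m where m: "n = Suc (Suc (m + i))"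
          using ij less_iff_Suc_add[of "Suc i" n] by (auto simp: add.commute)
        have "g (Suc i) = u j * u m" "n - 1 - i = Suc m" "n - i = Suc (Suc m)"
          using 4 m by (auto simp: g_def max_def min_def)
        then show ?thesis using 4 g m by (simp add: rec algebra_simps)
      qed
    qed
  qed
  also have "\<dots> = (w \<cdot>\<^sub>m 1\<^sub>m n) $$ (i, j)"
    using ij by simp
  finally show "(T_tilde n b bt * green_mat u n) $$ (i, j) = (w \<cdot>\<^sub>m 1\<^sub>m n) $$ (i, j)" .
qed (simp_all add: green_mat_def T_tilde_def)

text \<open>Stated without division by \<open>w\<close>, because \<open>w \<noteq> 0\<close> is
  itself deduced from this equation later.\<close>

lemma left_inverse_of_scalar_product:
  fixes A B G :: "'a :: field mat"
  assumes "A \<in> carrier_mat n n" "B \<in> carrier_mat n n" "G \<in> carrier_mat n n"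
    and "B * A = 1\<^sub>m n" and "A * G = w \<cdot>\<^sub>m 1\<^sub>m n"
  shows "G = w \<cdot>\<^sub>m B"
proof -
  have "G = B * A * G" using assms by simp
  also have "\<dots> = B * (w \<cdot>\<^sub>m 1\<^sub>m n)" using assms assoc_mult_mat[of B n n A n G n] by simp
  also have "\<dots> = w \<cdot>\<^sub>m B"
    using assms(2) mult_smult_distrib[of B n n "1\<^sub>m n" n w] by simp
  finally show ?thesis .
qed

section \<open>Algebra of two exponential sequences\<close>

lemma sum_power_mult_reverse:
  fixes x y :: "'a :: comm_ring_1"
  shows "(x - y) * (\<Sum>i<n. x ^ i * y ^ (n - 1 - i)) = x ^ n - y ^ n"
proof (cases n)
  case (Suc m)
  then show ?thesis
    using power_diff_sumr2[of x n y] by (simp add: mult.commute)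
qed simp

text \<open>The mixed terms in \<open>A * C\<close> cancel because \<open>x * y = 1\<close>, and the
  squares simplify by \<open>x\<^sup>2 - 1 = x * (x - y)\<close> and its mirror image. The result
  depends on \<open>i + m\<close> only, hence is constant along a fixed \<open>n\<close>.\<close>

lemma exponential_pair_casoratian:
  fixes x y A C :: "'a :: idom"
  assumes xy: "x * y = 1"
  defines "u \<equiv> \<lambda>i. A * x ^ i - C * y ^ i"
  shows "u (Suc i) * u (Suc m) - u i * u m =
    (x - y) * (A\<^sup>2 * x ^ (i + m + 1) - C\<^sup>2 * y ^ (i + m + 1))"
proof -
  have "(A * (x * a) - C * (y * c)) * (A * (x * a') - C * (y * c')) - (A * a - C * c) * (A * a' - C * c')
      = (x - y) * (A\<^sup>2 * (a * a' * x) - C\<^sup>2 * (c * c' * y))" for a a' c c'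
    using xy by Groebner_Basis.algebra
  from this[of "x ^ i" "y ^ i" "x ^ m" "y ^ m"] show ?thesis
    by (simp add: u_def power_add mult_ac)
qed

text \<open>The square terms do not depend on \<open>i\<close>; the two mixed terms are geometric
  sums with equal values, whence the factor 2. The factor \<open>x - y\<close> replaces a
  division.\<close>

lemma exponential_pair_convolution:
  fixes x y A C :: "'a :: idom"
  defines "u \<equiv> \<lambda>i. A * x ^ i - C * y ^ i"
  shows "(x - y) * (\<Sum>i<n. u i * u (n - 1 - i)) =
    (x - y) * (of_nat n * (A\<^sup>2 * x ^ (n - 1) + C\<^sup>2 * y ^ (n - 1))) - 2 * (A * C) * (x ^ n - y ^ n)"
proof -
  have p: "z ^ i * z ^ (n - 1 - i) = z ^ (n - 1)" if "i < n" for z :: 'a and i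
    using that by (simp flip: power_add)
  have "(\<Sum>i<n. u i * u (n - 1 - i)) =
    (\<Sum>i<n. (A\<^sup>2 * x ^ (n - 1) + C\<^sup>2 * y ^ (n - 1))
       - A * C * (x ^ i * y ^ (n - 1 - i)) - A * C * (y ^ i * x ^ (n - 1 - i)))"
  proof (rule sum.cong)
    fix i assume "i \<in> {..<n}"
    then have i: "i < n" by simp
    have "(A * a - C * c) * (A * a' - C * c') =
        (A\<^sup>2 * (a * a') + C\<^sup>2 * (c * c')) - A * C * (a * c') - A * C * (c * a')" for a a' c c'
      by Groebner_Basis.algebra
    then show "u i * u (n - 1 - i) = (A\<^sup>2 * x ^ (n - 1) + C\<^sup>2 * y ^ (n - 1))
       - A * C * (x ^ i * y ^ (n - 1 - i)) - A * C * (y ^ i * x ^ (n - 1 - i))"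
      unfolding u_def p[OF i, symmetric] .
  qed simp
  also have "\<dots> = of_nat n * (A\<^sup>2 * x ^ (n - 1) + C\<^sup>2 * y ^ (n - 1))
      - A * C * (\<Sum>i<n. x ^ i * y ^ (n - 1 - i)) - A * C * (\<Sum>i<n. y ^ i * x ^ (n - 1 - i))"
    by (simp add: sum_subtractf sum_distrib_left)
  finally have sum: "(\<Sum>i<n. u i * u (n - 1 - i)) = \<dots>" .
  have "(x - y) * (k - A * C * s - A * C * t) =
      (x - y) * k - A * C * ((x - y) * s) + A * C * ((y - x) * t)" for k s t
    by (simp add: algebra_simps)
  then show ?thesis
    unfolding sum by (simp only: sum_power_mult_reverse) (simp add: algebra_simps)
qed

text \<open>Here \<open>p\<close>, \<open>q\<close> stand for the powers of \<open>x\<close>,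
  \<open>y\<close> with exponent \<open>n - 1\<close>, and \<open>N\<close> for \<open>n\<close>, so
  no symbolic exponent remains. The first identity factors the common denominator of
  \<open>K1\<close> and \<open>K2\<close>; the second is the trace formula cleared of
  denominators.\<close>

lemma trace_formula_identity:
  fixes x y p q \<beta> N :: "'a :: idom"
  assumes xy: "x * y = 1" and pq: "p * q = 1"
  defines "g \<equiv> p * x\<^sup>2 - q * y\<^sup>2" and "h \<equiv> p * x - q * y" and "S \<equiv> p * x\<^sup>2 + q * y\<^sup>2"
  shows "(g + \<beta> * h)\<^sup>2 - \<beta>\<^sup>2 * (x - y)\<^sup>2 = g * ((x + \<beta>)\<^sup>2 * p - (y + \<beta>)\<^sup>2 * q)"
    and "g\<^sup>2 * ((x - y) * (N * ((x + \<beta>)\<^sup>2 * p + (y + \<beta>)\<^sup>2 * q)) - 2 * ((x + \<beta>) * (y + \<beta>)) * h) =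
      ((g + \<beta> * h)\<^sup>2 + \<beta>\<^sup>2 * (x - y)\<^sup>2) * ((N + 1) * (x - y) * S - (x + y) * g)
      - \<beta> * (g + \<beta> * h) * (x - y) * ((x + y) * S * g - (x - y) * g\<^sup>2 - 4 * (N + 1) * (x - y))"
proof -
  show "(g + \<beta> * h)\<^sup>2 - \<beta>\<^sup>2 * (x - y)\<^sup>2 = g * ((x + \<beta>)\<^sup>2 * p - (y + \<beta>)\<^sup>2 * q)"
    using xy pq unfolding g_def h_def by Groebner_Basis.algebra
  \<comment> \<open>The claim is affine in \<open>N\<close>: this is the coefficient of
    \<open>N\<close> with \<open>x - y\<close> divided out, and the next identity is the part free
    of \<open>N\<close>.\<close>
  have "g\<^sup>2 * ((x + \<beta>)\<^sup>2 * p + (y + \<beta>)\<^sup>2 * q) =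
      ((g + \<beta> * h)\<^sup>2 + \<beta>\<^sup>2 * (x - y)\<^sup>2) * S + 4 * \<beta> * (g + \<beta> * h) * (x - y)"
    using xy pq unfolding g_def h_def S_def by Groebner_Basis.algebra
  moreover have "- 2 * g\<^sup>2 * ((x + \<beta>) * (y + \<beta>)) * h =
      ((g + \<beta> * h)\<^sup>2 + \<beta>\<^sup>2 * (x - y)\<^sup>2) * ((x - y) * S - (x + y) * g)
      - \<beta> * (g + \<beta> * h) * (x - y) * ((x + y) * S * g - (x - y) * g\<^sup>2 - 4 * (x - y))"
    using xy pq unfolding g_def h_def S_def by Groebner_Basis.algebra
  ultimately show "g\<^sup>2 * ((x - y) * (N * ((x + \<beta>)\<^sup>2 * p + (y + \<beta>)\<^sup>2 * q)) - 2 * ((x + \<beta>) * (y + \<beta>)) * h) =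
      ((g + \<beta> * h)\<^sup>2 + \<beta>\<^sup>2 * (x - y)\<^sup>2) * ((N + 1) * (x - y) * S - (x + y) * g)
      - \<beta> * (g + \<beta> * h) * (x - y) * ((x + y) * S * g - (x - y) * g\<^sup>2 - 4 * (N + 1) * (x - y))"
    by Groebner_Basis.algebra
qed

section \<open>Characteristic roots for \<open>b < -2\<close>\<close>

lemma
  assumes "b < -2"
  shows r1_mult_r2: "r1 b * r2 b = 1"
    and r1_add_r2: "r1 b + r2 b = b"
    and r1_diff_r2: "r1 b - r2 b = sqrt (b\<^sup>2 - 4)"
    and discriminant_pos: "b\<^sup>2 - 4 > 0"
proof -
  have "0 < (b + 2) * (b - 2)" using assms by (intro mult_neg_neg) auto
  then show pos: "b\<^sup>2 - 4 > 0" by (simp add: algebra_simps power2_eq_square)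
  then have "(sqrt (b\<^sup>2 - 4))\<^sup>2 = b\<^sup>2 - 4" by simp
  then show "r1 b * r2 b = 1"
    by (simp add: r1_def r2_def field_simps power2_eq_square)
  show "r1 b + r2 b = b" "r1 b - r2 b = sqrt (b\<^sup>2 - 4)"
    by (simp_all add: r1_def r2_def field_simps)
qed

text \<open>Equal powers force equal absolute values, but the difference and the sum of the roots,
  \<open>sqrt (b\<^sup>2 - 4)\<close> and \<open>b\<close>, are both nonzero.\<close>

lemma gam_nonzero:
  assumes "b < -2" "k > 0"
  shows "gam b k \<noteq> 0"
proof
  assume "gam b k = 0"
  then have "\<bar>r1 b\<bar> ^ k = \<bar>r2 b\<bar> ^ k"
    by (simp add: gam_def flip: power_abs)
  then have "\<bar>r1 b\<bar> = \<bar>r2 b\<bar>"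
    using assms(2) by (simp add: power_eq_iff_eq_base)
  moreover have "r1 b \<noteq> r2 b" "r1 b + r2 b \<noteq> 0"
    using r1_diff_r2[OF assms(1)] r1_add_r2[OF assms(1)] discriminant_pos[OF assms(1)] assms(1)
    by auto
  ultimately show False by (auto simp: abs_eq_iff)
qed

theorem theorem4p2:
  fixes n :: nat and b bt \<beta> :: real
  assumes "n \<ge> 3"
    and "b < -2"
    and "invertible_mat (T_tilde n b bt)"
    and "\<beta> = bt - b"
  shows "mat_trace (the (mat_inverse (T_tilde n b bt))) =
    K1 n b \<beta> *
      (real (n + 1) / sqrt (b\<^sup>2 - 4) * ((r1 b ^ (n + 1) + r2 b ^ (n + 1)) / gam b (n + 1))
        - b / (b\<^sup>2 - 4))
    - K2 n b \<beta> *
      (b / sqrt (b\<^sup>2 - 4) * (r1 b ^ (n + 1) + r2 b ^ (n + 1))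
        - gam b (n + 1) - 4 * real (n + 1) / gam b (n + 1))"
proof -
  define x y where "x = r1 b" and "y = r2 b"
  define s where "s = sqrt (b\<^sup>2 - 4)"
  define p q where "p = x ^ (n - 1)" and "q = y ^ (n - 1)"
  \<comment> \<open>Collecting powers in \<open>gam b (i + 1) + \<beta> * gam b i\<close> gives
    these coefficients of \<open>x ^ i\<close> and \<open>y ^ i\<close>.\<close>
  define A C where "A = x + \<beta>" and "C = y + \<beta>"
  define u where "u = (\<lambda>i. A * x ^ i - C * y ^ i)"
  define e where "e = A\<^sup>2 * p - C\<^sup>2 * q"
  define w where "w = s * e"
  define B where "B = the (mat_inverse (T_tilde n b bt))"
  define g where "g = gam b (n + 1)"
  define h where "h = gam b n"
  define S where "S = r1 b ^ (n + 1) + r2 b ^ (n + 1)"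
  have xy: "x * y = 1" and xpy: "x + y = b" and xmy: "x - y = s"
    using r1_mult_r2 r1_add_r2 r1_diff_r2 assms(2) by (simp_all add: x_def y_def s_def)
  have s2: "s\<^sup>2 = b\<^sup>2 - 4" and s: "s \<noteq> 0"
    using discriminant_pos[OF assms(2)] by (simp_all add: s_def)
  have pq: "p * q = 1" by (simp add: p_def q_def xy flip: power_mult_distrib)
  have u0: "u 0 = s" by (simp add: u_def A_def C_def xmy)
  have "u 1 = (x + y + \<beta>) * (x - y)" by (simp add: u_def A_def C_def algebra_simps)
  then have u1: "u 1 = bt * u 0" using assms(4) u0 by (simp add: xpy xmy)
  have rec: "u (Suc (Suc i)) = b * u (Suc i) - u i" for i
  proof -
    have "A * (x * (x * a)) - C * (y * (y * c)) =
        (x + y) * (A * (x * a) - C * (y * c)) - (A * a - C * c)" for a c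
      using xy by Groebner_Basis.algebra
    from this[of "x ^ i" "y ^ i"] show ?thesis by (simp add: u_def xpy)
  qed
  have cas: "u (Suc i) * u (n - 1 - i) - u i * u (n - 2 - i) = w" if "Suc i < n" for i
  proof -
    \<comment> \<open>With this \<open>m\<close> the exponent \<open>i + m + 1\<close> of the
      Casoratian is \<open>n - 1\<close>, which turns the powers into \<open>p\<close> and
      \<open>q\<close>.\<close>
    obtain m where m: "n = Suc (Suc (i + m))"
      using \<open>Suc i < n\<close> less_iff_Suc_add[of "Suc i" n] by auto
    show ?thesis
      using exponential_pair_casoratian[OF xy, of A i C m]
      by (simp add: m u_def w_def e_def p_def q_def xmy)
  qed
  have TG: "T_tilde n b bt * green_mat u n = w \<cdot>\<^sub>m 1\<^sub>m n"
    using assms(1) u1 rec cas by (intro T_tilde_mult_green_mat) auto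
  have B: "B \<in> carrier_mat n n" "B * T_tilde n b bt = 1\<^sub>m n"
    using the_mat_inverse[OF T_tilde_carrier assms(3)] by (auto simp: B_def inverts_mat_def)
  have G: "green_mat u n = w \<cdot>\<^sub>m B"
    by (rule left_inverse_of_scalar_product[OF T_tilde_carrier B(1) green_mat_carrier B(2) TG])
  have "green_mat u n $$ (0, n - 1) = s * s"
    using assms(1) by (simp add: green_mat_def u0)
  \<comment> \<open>If \<open>w\<close> were 0, \<open>G\<close> would make every entry vanish,
    including this corner.\<close>
  then have w: "w \<noteq> 0"
    using s G B(1) assms(1) by auto
  then have e: "e \<noteq> 0" by (simp add: w_def)
  have "w * mat_trace B = (\<Sum>i<n. green_mat u n $$ (i, i))"
    using B(1) by (simp add: G mat_trace_def sum_distrib_left)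
  also have "\<dots> = (\<Sum>i<n. u i * u (n - 1 - i))"
    by (simp add: green_mat_def)
  finally have "s * (w * mat_trace B) =
      s * (real n * (A\<^sup>2 * p + C\<^sup>2 * q)) - 2 * (A * C) * h"
    using exponential_pair_convolution[of x y A C n]
    by (simp add: u_def p_def q_def h_def gam_def x_def y_def flip: xmy)
  moreover have gx: "g = p * x\<^sup>2 - q * y\<^sup>2" "h = p * x - q * y" "S = p * x\<^sup>2 + q * y\<^sup>2"
    using assms(1)
    by (simp_all add: g_def h_def S_def gam_def p_def q_def x_def[symmetric] y_def[symmetric]
        flip: power_add power_Suc2)
  moreover note trace_formula_identity(1)[OF xy pq, where \<beta> = \<beta>]
    trace_formula_identity(2)[OF xy pq, where \<beta> = \<beta> and N = "real n"]
  ultimately have D: "(g + \<beta> * h)\<^sup>2 - \<beta>\<^sup>2 * s\<^sup>2 = g * e"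
    and tr: "g\<^sup>2 * (s * (w * mat_trace B)) =
      ((g + \<beta> * h)\<^sup>2 + \<beta>\<^sup>2 * s\<^sup>2) * ((real n + 1) * s * S - b * g)
      - \<beta> * (g + \<beta> * h) * s * (b * S * g - s * g\<^sup>2 - 4 * (real n + 1) * s)"
    by (simp_all add: xmy xpy A_def C_def e_def)
  have g: "g \<noteq> 0" using gam_nonzero[OF assms(2)] by (simp add: g_def)
  \<comment> \<open>\<open>M\<close> and \<open>L\<close> are the numerators of \<open>K1\<close>
    and \<open>K2\<close>; by \<open>D\<close> their common denominator is
    \<open>g * e\<close>.\<close>
  define M where "M = (g + \<beta> * h)\<^sup>2 + \<beta>\<^sup>2 * s\<^sup>2"
  define L where "L = \<beta> * (g + \<beta> * h)"
  have "mat_trace B = (M * ((real n + 1) * s * S - b * g)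
      - L * s * (b * S * g - s * g\<^sup>2 - 4 * (real n + 1) * s)) / (g\<^sup>2 * (s * (s * e)))"
    using tr g s e by (simp add: eq_divide_eq w_def M_def L_def mult_ac)
  also have "\<dots> = M / (g * e) * ((real n + 1) / s * (S / g) - b / s\<^sup>2)
      - L / (g * e) * (b / s * S - g - 4 * (real n + 1) / g)"
    using g s e by (simp add: divide_simps) Groebner_Basis.algebra
  also have "M / (g * e) = K1 n b \<beta>"
    unfolding D[symmetric] unfolding K1_def M_def g_def h_def s2 by simp
  also have "L / (g * e) = K2 n b \<beta>"
    unfolding D[symmetric] unfolding K2_def L_def g_def h_def s2 by simp
  finally show ?thesis
    unfolding B_def[symmetric] s_def[symmetric] g_def[symmetric] S_def[symmetric]
    unfolding s2[symmetric] by (simp add: add.commute)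
qed

end
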